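(* Let $n\ge 1$, let $A=(a_{ij})_{i,j=1}^n$ be a matrix with nonnegative real entries, and let $B=(b_{ij})_{i,j=1}^n$ be a doubly stochastic matrix. Then \[ \operatorname{Per}(A)\ \ge\ \prod_{i,j=1}^n (1-b_{ij})^{1-b_{ij}}\cdot \exp\Big\{-\sum_{i,j=1}^n b_{ij}\log\frac{b_{ij}}{a_{ij}}\Big\}. \] In particular, if $A$ itself is doubly stochastic, then $\operatorname{Per}(A)\ge \prod_{i,j=1}^n (1-a_{ij})^{1-a_{ij}}$.
   Context: $\operatorname{Per}(A)=\sum_{\sigma\in S_n}\prod_{i=1}^n a_{i\sigma(i)}$ is the permanent. A matrix is doubly stochastic if its entries are nonnegative and all row and column sums equal $1$. Conventions: $0^0=1$; a term with $b_{ij}=0$ contributes $0$ to the sum $\sum b_{ij}\log(b_{ij}/a_{ij})$; if $b_{ij}>0$ and $a_{ij}=0$ the term is $+\infty$, so the right-hand side is $0$. *)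

theory Defs
  imports "HOL-Analysis.Analysis" "HOL-Combinatorics.Permutations"
begin

definition per :: "real^'n^'n \<Rightarrow> real" where
  "per A = (\<Sum>\<sigma> | \<sigma> permutes (UNIV :: 'n set). \<Prod>i\<in>UNIV. A $ i $ (\<sigma> i))"

definition nonneg_mat :: "real^'n^'n \<Rightarrow> bool" where
  "nonneg_mat A \<longleftrightarrow> (\<forall>i j. A $ i $ j \<ge> 0)"

definition doubly_stochastic :: "real^'n^'n \<Rightarrow> bool" where
  "doubly_stochastic A \<longleftrightarrow> nonneg_mat A \<and>
     (\<forall>i. (\<Sum>j\<in>UNIV. A $ i $ j) = 1) \<and> (\<forall>j. (\<Sum>i\<in>UNIV. A $ i $ j) = 1)"

definition pow0 :: "real \<Rightarrow> real \<Rightarrow> real" where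
  "pow0 x y = (if x = 0 then (if y = 0 then 1 else 0) else x powr y)"

text \<open>Single term b log(b/a) of the divergence, with b = 0 contributing 0.
  (The case b > 0, a = 0 is treated separately as +infinity.)\<close>
definition kl_term :: "real \<Rightarrow> real \<Rightarrow> real" where
  "kl_term b a = (if b = 0 then 0 else b * ln (b / a))"

text \<open>Right-hand side of the bound: equals 0 when some b_ij > 0 with a_ij = 0
  (divergence is +infinity), otherwise the stated product times exp(-divergence).\<close>
definition per_lower_bound :: "real^'n^'n \<Rightarrow> real^'n^'n \<Rightarrow> real" where
  "per_lower_bound A B =
     (if \<exists>i j. B $ i $ j > 0 \<and> A $ i $ j = 0 then 0
      else (\<Prod>i\<in>UNIV. \<Prod>j\<in>UNIV. pow0 (1 - B $ i $ j) (1 - B $ i $ j)) *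
           exp (- (\<Sum>i\<in>UNIV. \<Sum>j\<in>UNIV. kl_term (B $ i $ j) (A $ i $ j))))"

end

theory Submission
  imports Defs
begin

text \<open>
  The permanent pairs the row polynomial \<open>\<Prod>\<^sub>i \<Sum>\<^sub>j a\<^sub>i\<^sub>j y\<^sub>i\<^sub>j\<close> with the column polynomial
  \<open>\<Prod>\<^sub>j \<Sum>\<^sub>i z\<^sub>i\<^sub>j\<close>: multiply them and, for one edge \<open>e\<close> after the other, replace
  \<open>R00 + R10 y\<^sub>e + R01 z\<^sub>e + R11 y\<^sub>e z\<^sub>e\<close> by \<open>R00 + R11\<close>. At each stage the result is a
  monomer-dimer partition function of a bipartite graph, whose dimers are the edges already
  eliminated and whose monomer weights are linear forms in the remaining variables. For such
  functions a Heilmann-Lieb recursion gives \<open>R10 R01 \<le> R00 R11\<close>, and therefore each elimination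
  decreases the infimum of \<open>R / \<Prod>\<^sub>e (y\<^sub>e z\<^sub>e) powr b\<^sub>e\<close> at most by the factor
  \<open>b\<^sub>e powr b\<^sub>e * (1 - b\<^sub>e) powr (1 - b\<^sub>e)\<close>. The initial infimum is bounded by the weighted AM-GM
  inequality; after the last elimination only the permanent is left.
\<close>

section \<open>The monomer-dimer partition function of a bipartite graph\<close>

definition matchings :: "'a set \<Rightarrow> 'b set \<Rightarrow> ('a \<times> 'b) set set" where
  "matchings I J = {M. M \<subseteq> I \<times> J \<and> inj_on fst M \<and> inj_on snd M}"

text \<open>The two vertex sets are arguments apart from the weights, so that deleting a vertex
  changes only \<open>I\<close> or \<open>J\<close>; the recursions and correlation inequalities
  compare such deletions under fixed weights.\<close>

definition monomer_dimer ::
  "('a \<Rightarrow> 'b \<Rightarrow> real) \<Rightarrow> ('a \<Rightarrow> real) \<Rightarrow> ('b \<Rightarrow> real) \<Rightarrow> 'a set \<Rightarrow> 'b set \<Rightarrow> real" where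
  "monomer_dimer w r c I J =
     (\<Sum>M\<in>matchings I J. (\<Prod>e\<in>M. w (fst e) (snd e)) *
        (\<Prod>i\<in>I - fst ` M. r i) * (\<Prod>j\<in>J - snd ` M. c j))"

section \<open>Expansion of the partition function along one vertex\<close>

lemma finite_matchings: "finite I \<Longrightarrow> finite J \<Longrightarrow> finite (matchings I J)"
  unfolding matchings_def by (rule finite_subset[of _ "Pow (I \<times> J)"]) auto

text \<open>Either \<open>i\<close> is uncovered, or it has a unique partner \<open>k\<close>, and
  removing the edge \<open>(i, k)\<close> leaves a matching that avoids both ends.\<close>

lemma matchings_insert_row:
  assumes "i \<notin> I"
  shows "matchings (insert i I) J =
           matchings I J \<union> (\<Union>k\<in>J. insert (i, k) ` matchings I (J - {k}))" (is "?L = ?R")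
proof
  show "?R \<subseteq> ?L"
    using assms by (auto simp: matchings_def)
  show "?L \<subseteq> ?R"
  proof
    fix M assume M: "M \<in> ?L"
    show "M \<in> ?R"
    proof (cases "\<exists>k. (i, k) \<in> M")
      case False
      then have "M \<in> matchings I J"
        using M unfolding matchings_def by auto
      then show ?thesis by blast
    next
      case True
      then obtain k where k: "(i, k) \<in> M" by blast
      have "M - {(i, k)} \<in> matchings I (J - {k})"
        unfolding matchings_def
      proof (intro CollectI conjI subsetI)
        fix e assume e: "e \<in> M - {(i, k)}"
        have "inj_on fst M" "inj_on snd M" "e \<in> insert i I \<times> J"
          using M e by (auto simp: matchings_def)
        then have "fst e \<noteq> i" "snd e \<noteq> k" "e \<in> insert i I \<times> J"
          using k e inj_onD[of fst M e "(i, k)"] inj_onD[of snd M e "(i, k)"] by auto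
        then show "e \<in> I \<times> (J - {k})" by auto
      qed (use M in \<open>auto simp: matchings_def intro: inj_on_diff\<close>)
      moreover have "M = insert (i, k) (M - {(i, k)})" "k \<in> J"
        using M k unfolding matchings_def by auto
      ultimately show ?thesis by blast
    qed
  qed
qed

lemma monomer_dimer_insert_row:
  assumes fin: "finite I" "finite J" and i: "i \<notin> I"
  shows "monomer_dimer w r c (insert i I) J =
           r i * monomer_dimer w r c I J + (\<Sum>k\<in>J. w i k * monomer_dimer w r c I (J - {k}))"
proof -
  define t where "t I J M = (\<Prod>e\<in>M. w (fst e) (snd e)) *
        (\<Prod>i\<in>I - fst ` M. r i) * (\<Prod>j\<in>J - snd ` M. c j)" for I J M
  have md: "monomer_dimer w r c I J = sum (t I J) (matchings I J)" for I J
    unfolding monomer_dimer_def t_def ..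
  have finM: "finite (matchings I J')" if "J' \<subseteq> J" for J'
    using fin finite_subset[OF that] finite_matchings by blast
  have "monomer_dimer w r c (insert i I) J =
      sum (t (insert i I) J) (matchings I J) +
      sum (t (insert i I) J) (\<Union>k\<in>J. insert (i, k) ` matchings I (J - {k}))"
    unfolding md matchings_insert_row[OF i]
    by (rule sum.union_disjoint) (use fin finM i in \<open>auto simp: matchings_def\<close>)
  also have "sum (t (insert i I) J) (matchings I J) = r i * monomer_dimer w r c I J"
    unfolding md sum_distrib_left
  proof (rule sum.cong)
    fix M assume "M \<in> matchings I J"
    then have "insert i I - fst ` M = insert i (I - fst ` M)"
      using i by (auto simp: matchings_def)
    then show "t (insert i I) J M = r i * t I J M"
      using fin i by (simp add: t_def)
  qed simp
  also have "sum (t (insert i I) J) (\<Union>k\<in>J. insert (i, k) ` matchings I (J - {k})) =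
      (\<Sum>k\<in>J. sum (t (insert i I) J) (insert (i, k) ` matchings I (J - {k})))"
  proof (rule sum.UNION_disjoint)
    show "\<forall>k\<in>J. \<forall>k'\<in>J. k \<noteq> k' \<longrightarrow> insert (i, k) ` matchings I (J - {k}) \<inter>
        insert (i, k') ` matchings I (J - {k'}) = {}"
    proof (intro ballI impI equals0I)
      fix k k' M
      assume "k \<noteq> k'"
        and M: "M \<in> insert (i, k) ` matchings I (J - {k}) \<inter> insert (i, k') ` matchings I (J - {k'})"
      have "(i, k') \<in> M" using M by blast
      moreover obtain N where "M = insert (i, k) N" "N \<in> matchings I (J - {k})"
        using M by blast
      moreover from this have "N \<subseteq> I \<times> (J - {k})" by (simp add: matchings_def)
      ultimately have "(i, k') \<in> insert (i, k) N" "N \<subseteq> I \<times> (J - {k})" by simp_all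
      then show False using \<open>k \<noteq> k'\<close> i by auto
    qed
  qed (use fin finM in auto)
  also have "\<dots> = (\<Sum>k\<in>J. w i k * monomer_dimer w r c I (J - {k}))"
  proof (rule sum.cong)
    fix k assume k: "k \<in> J"
    have notin: "(i, k) \<notin> M" if "M \<in> matchings I (J - {k})" for M
      using that i by (auto simp: matchings_def)
    have "inj_on (insert (i, k)) (matchings I (J - {k}))"
      by (rule inj_onI) (metis notin insert_ident)
    then have "sum (t (insert i I) J) (insert (i, k) ` matchings I (J - {k})) =
        (\<Sum>M\<in>matchings I (J - {k}). t (insert i I) J (insert (i, k) M))"
      by (simp add: sum.reindex)
    also have "\<dots> = (\<Sum>M\<in>matchings I (J - {k}). w i k * t I (J - {k}) M)"
    proof (rule sum.cong)
      fix M assume M: "M \<in> matchings I (J - {k})"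
      have "finite M"
        using M fin by (auto simp: matchings_def intro: finite_subset[of M "I \<times> (J - {k})"])
      moreover have "insert i I - fst ` insert (i, k) M = I - fst ` M"
        "J - snd ` insert (i, k) M = J - {k} - snd ` M"
        using M i by (auto simp: matchings_def)
      ultimately show "t (insert i I) J (insert (i, k) M) = w i k * t I (J - {k}) M"
        using notin[OF M] unfolding t_def by (simp add: mult.assoc)
    qed simp
    finally show "sum (t (insert i I) J) (insert (i, k) ` matchings I (J - {k})) =
        w i k * monomer_dimer w r c I (J - {k})"
      unfolding md sum_distrib_left .
  qed simp
  finally show ?thesis .
qed

text \<open>Reversing edges is a bijection between matchings. It transfers every row identity to
  columns.\<close>

lemma monomer_dimer_swap:
  "monomer_dimer w r c I J = monomer_dimer (\<lambda>j i. w i j) c r J I"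
proof -
  have sw: "(`) prod.swap ` matchings J I = matchings I J" (is "?L = ?R") for I :: "'x set" and J :: "'y set"
  proof -
    \<comment> \<open>The type variables are fresh because both inclusions below use this fact, with
      the two vertex types exchanged.\<close>
    have sub: "prod.swap ` M \<in> matchings I J" if "M \<in> matchings J I"
      for M and I :: "'u set" and J :: "'v set"
      using that by (auto simp: matchings_def inj_on_def)
    show ?thesis
    proof
      show "?L \<subseteq> ?R" using sub by blast
      show "?R \<subseteq> ?L"
      proof
        fix M assume "M \<in> ?R"
        then have "prod.swap ` M \<in> matchings J I" by (rule sub)
        moreover have "M = prod.swap ` (prod.swap ` M)" by (simp add: image_comp)
        ultimately show "M \<in> ?L" by blast
      qed
    qed
  qed
  have inj: "inj_on ((`) prod.swap) (matchings J I)"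
    by (metis inj_image_eq_iff inj_onI inj_swap)
  have "monomer_dimer w r c I J = (\<Sum>M\<in>matchings J I. (\<Prod>e\<in>prod.swap ` M. w (fst e) (snd e)) *
        (\<Prod>i\<in>I - fst ` prod.swap ` M. r i) * (\<Prod>j\<in>J - snd ` prod.swap ` M. c j))"
    unfolding monomer_dimer_def sw[of J I, symmetric] by (simp add: sum.reindex[OF inj])
  also have "\<dots> = monomer_dimer (\<lambda>j i. w i j) c r J I"
    unfolding monomer_dimer_def
  proof (rule sum.cong)
    fix M assume "M \<in> matchings J I"
    have "(\<Prod>e\<in>prod.swap ` M. w (fst e) (snd e)) = (\<Prod>e\<in>M. w (snd e) (fst e))"
      by (subst prod.reindex) (auto simp: inj_on_def)
    then show "(\<Prod>e\<in>prod.swap ` M. w (fst e) (snd e)) *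
        (\<Prod>i\<in>I - fst ` prod.swap ` M. r i) * (\<Prod>j\<in>J - snd ` prod.swap ` M. c j) =
      (\<Prod>e\<in>M. w (snd e) (fst e)) * (\<Prod>i\<in>J - fst ` M. c i) * (\<Prod>j\<in>I - snd ` M. r j)"
      by (simp add: image_comp comp_def mult_ac)
  qed simp
  finally show ?thesis .
qed

lemma monomer_dimer_insert_col:
  assumes "finite I" "finite J" "j \<notin> J"
  shows "monomer_dimer w r c I (insert j J) =
           c j * monomer_dimer w r c I J + (\<Sum>k\<in>I. w k j * monomer_dimer w r c (I - {k}) J)"
  using monomer_dimer_insert_row[OF assms(2,1,3), of "\<lambda>j i. w i j" c r]
  by (simp add: monomer_dimer_swap[of w r c])

lemma monomer_dimer_cong:
  assumes "\<And>i j. i \<in> I \<Longrightarrow> j \<in> J \<Longrightarrow> w i j = w' i j"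
    and "\<And>i. i \<in> I \<Longrightarrow> r i = r' i" and "\<And>j. j \<in> J \<Longrightarrow> c j = c' j"
  shows "monomer_dimer w r c I J = monomer_dimer w' r' c' I J"
  unfolding monomer_dimer_def
proof (rule sum.cong)
  fix M assume "M \<in> matchings I J"
  then have "(\<Prod>e\<in>M. w (fst e) (snd e)) = (\<Prod>e\<in>M. w' (fst e) (snd e))"
    using assms(1) by (intro prod.cong) (auto simp: matchings_def)
  then show "(\<Prod>e\<in>M. w (fst e) (snd e)) * (\<Prod>i\<in>I - fst ` M. r i) * (\<Prod>j\<in>J - snd ` M. c j) =
      (\<Prod>e\<in>M. w' (fst e) (snd e)) * (\<Prod>i\<in>I - fst ` M. r' i) * (\<Prod>j\<in>J - snd ` M. c' j)"
    using assms(2,3) by simp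
qed simp

lemma monomer_dimer_nonneg:
  assumes "\<And>i j. w i j \<ge> 0" "\<And>i. r i \<ge> 0" "\<And>j. c j \<ge> 0"
  shows "monomer_dimer w r c I J \<ge> 0"
  unfolding monomer_dimer_def using assms by (intro sum_nonneg mult_nonneg_nonneg prod_nonneg) auto

text \<open>Only the empty matching survives. This is the initial stage, where no edge has been
  eliminated.\<close>

lemma monomer_dimer_no_dimers:
  assumes "finite I" "finite J"
  shows "monomer_dimer (\<lambda>i j. 0) r c I J = (\<Prod>i\<in>I. r i) * (\<Prod>j\<in>J. c j)"
proof -
  have M: "{} \<in> matchings I J" by (simp add: matchings_def)
  have fin: "finite M" if "M \<in> matchings I J" for M
    using that assms by (auto simp: matchings_def intro: finite_subset)
  have "monomer_dimer (\<lambda>i j. 0) r c I J = (\<Sum>M\<in>{{}}. (\<Prod>e\<in>M. (0::real)) *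
        (\<Prod>i\<in>I - fst ` M. r i) * (\<Prod>j\<in>J - snd ` M. c j))"
    unfolding monomer_dimer_def
    by (rule sum.mono_neutral_right)
      (use M fin finite_matchings[OF assms] in \<open>auto simp: prod_constant card_eq_0_iff\<close>)
  then show ?thesis by simp
qed

section \<open>Correlation inequalities for vertex deletion\<close>

text \<open>The two inequalities feed each other in an induction on \<open>I\<close> with
  \<open>J\<close> arbitrary. Expanding along column \<open>j\<close> reduces \<open>?same\<close>
  for \<open>I\<close> termwise to \<open>?opp\<close> for \<open>I - {l}\<close>; expanding along
  row \<open>i\<close> reduces \<open>?opp\<close> for \<open>I\<close> termwise to
  \<open>?same\<close> for the same \<open>I\<close>.\<close>

lemma monomer_dimer_rayleigh:
  assumes w: "\<And>i j. w i j \<ge> 0" and r: "\<And>i. r i \<ge> 0" and c: "\<And>j. c j \<ge> 0"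
    and "finite I" "finite J"
  shows "i \<notin> I \<Longrightarrow> j \<notin> J \<Longrightarrow>
      monomer_dimer w r c I (insert j J) * monomer_dimer w r c (insert i I) J
      \<le> monomer_dimer w r c (insert i I) (insert j J) * monomer_dimer w r c I J" (is "_ \<Longrightarrow> _ \<Longrightarrow> ?opp I J i j")
    and "j \<noteq> k \<Longrightarrow> j \<notin> J \<Longrightarrow> k \<notin> J \<Longrightarrow>
      monomer_dimer w r c I (insert j (insert k J)) * monomer_dimer w r c I J
      \<le> monomer_dimer w r c I (insert j J) * monomer_dimer w r c I (insert k J)" (is "_ \<Longrightarrow> _ \<Longrightarrow> _ \<Longrightarrow> ?same I J j k")
proof -
  let ?Z = "monomer_dimer w r c"
  have "(\<forall>J i j. finite J \<longrightarrow> i \<notin> I \<longrightarrow> j \<notin> J \<longrightarrow> ?opp I J i j) \<and>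
        (\<forall>J j k. finite J \<longrightarrow> j \<noteq> k \<longrightarrow> j \<notin> J \<longrightarrow> k \<notin> J \<longrightarrow> ?same I J j k)"
    using \<open>finite I\<close>
  proof (induction I rule: finite_psubset_induct)
    case (psubset I)
    have same: "?same I J j k" if J: "finite J" "j \<noteq> k" "j \<notin> J" "k \<notin> J" for J j k
    proof -
      have *: "?Z (I - {l}) (insert k J) * ?Z I J \<le> ?Z (I - {l}) J * ?Z I (insert k J)" if "l \<in> I" for l
      proof -
        have "?opp (I - {l}) J l k"
          using psubset.IH[of "I - {l}"] that J by blast
        moreover have "insert l (I - {l}) = I" using that by blast
        ultimately show ?thesis by (simp add: mult.commute)
      qed
      have "?Z I (insert j (insert k J)) * ?Z I J = c j * ?Z I J * ?Z I (insert k J)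
          + (\<Sum>l\<in>I. w l j * (?Z (I - {l}) (insert k J) * ?Z I J))"
        using J psubset.hyps by (simp add: monomer_dimer_insert_col[of I "insert k J" j]
            ring_distribs sum_distrib_right sum_distrib_left mult_ac)
      also have "\<dots> \<le> c j * ?Z I J * ?Z I (insert k J)
          + (\<Sum>l\<in>I. w l j * (?Z (I - {l}) J * ?Z I (insert k J)))"
        using * w by (intro add_left_mono sum_mono mult_left_mono) auto
      also have "\<dots> = ?Z I (insert j J) * ?Z I (insert k J)"
        using J psubset.hyps by (simp add: monomer_dimer_insert_col[of I J j]
            ring_distribs sum_distrib_right sum_distrib_left mult_ac)
      finally show ?thesis .
    qed
    have opp: "?opp I J i j" if J: "finite J" "i \<notin> I" "j \<notin> J" for J i j
    proof -
      have *: "?Z I (J - {k}) * ?Z I (insert j J) \<le> ?Z I (insert j J - {k}) * ?Z I J" if "k \<in> J" for k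
      proof -
        have "?same I (J - {k}) j k"
          by (rule same) (use J that in auto)
        moreover have "insert k (J - {k}) = J" "insert j J - {k} = insert j (J - {k})"
          using that J by auto
        ultimately show ?thesis by (simp add: mult.commute)
      qed
      have jj: "insert j J - {j} = J" using J by simp
      have "?Z I (insert j J) * ?Z (insert i I) J = r i * ?Z I J * ?Z I (insert j J)
          + (\<Sum>k\<in>J. w i k * (?Z I (J - {k}) * ?Z I (insert j J)))"
        using J psubset.hyps by (simp add: monomer_dimer_insert_row[of I J i]
            ring_distribs sum_distrib_right sum_distrib_left mult_ac)
      also have "\<dots> \<le> r i * ?Z I J * ?Z I (insert j J)
          + (\<Sum>k\<in>J. w i k * (?Z I (insert j J - {k}) * ?Z I J))"
        using * w by (intro add_left_mono sum_mono mult_left_mono) auto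
      \<comment> \<open>The edge \<open>(i, j)\<close> occurs only in the expansion of the
        right-hand side, where it contributes \<open>w i j\<close> times a square.\<close>
      also have "\<dots> \<le> \<dots> + w i j * (?Z I J * ?Z I J)"
        using w by simp
      also have "\<dots> = ?Z (insert i I) (insert j J) * ?Z I J"
        using J psubset.hyps by (simp add: monomer_dimer_insert_row[of I "insert j J" i] jj
            ring_distribs sum_distrib_right sum_distrib_left mult_ac)
      finally show ?thesis .
    qed
    show ?case using same opp by blast
  qed
  then show "i \<notin> I \<Longrightarrow> j \<notin> J \<Longrightarrow> ?opp I J i j"
    and "j \<noteq> k \<Longrightarrow> j \<notin> J \<Longrightarrow> k \<notin> J \<Longrightarrow> ?same I J j k"
    using \<open>finite J\<close> by blast+
qed

section \<open>Dependence on a single weight\<close>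

text \<open>A matching uses the weight of \<open>i\<close> at most once, so the partition function
  is affine in it, and its coefficient is the partition function with \<open>i\<close>
  deleted.\<close>

lemma monomer_dimer_add_row:
  assumes "finite I" "finite J" "i \<notin> I"
  shows "monomer_dimer w (\<lambda>k. r k + (if k = i then t else 0)) c (insert i I) J =
           monomer_dimer w r c (insert i I) J + t * monomer_dimer w r c I J"
proof -
  have "monomer_dimer w (\<lambda>k. r k + (if k = i then t else 0)) c I J' = monomer_dimer w r c I J'" for J'
    by (rule monomer_dimer_cong) (use assms in auto)
  then show ?thesis
    using assms by (simp add: monomer_dimer_insert_row algebra_simps)
qed

lemma monomer_dimer_add_col:
  assumes "finite I" "finite J" "j \<notin> J"
  shows "monomer_dimer w r (\<lambda>k. c k + (if k = j then t else 0)) I (insert j J) =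
           monomer_dimer w r c I (insert j J) + t * monomer_dimer w r c I J"
  using monomer_dimer_add_row[OF assms(2,1,3), of "\<lambda>j i. w i j" c t r]
  by (simp add: monomer_dimer_swap[of w r])

text \<open>The coefficient of a dimer weight deletes both ends of the edge, exactly like the
  coefficient of the product of the two monomer weights. This is why passing to
  \<open>R00 + R11\<close> turns an edge into a dimer.\<close>

lemma monomer_dimer_add_edge:
  assumes "finite I" "finite J" "i \<notin> I" "j \<notin> J"
  shows "monomer_dimer (\<lambda>k l. w k l + (if k = i \<and> l = j then t else 0)) r c (insert i I) (insert j J) =
           monomer_dimer w r c (insert i I) (insert j J) + t * monomer_dimer w r c I J"
proof -
  have "monomer_dimer (\<lambda>k l. w k l + (if k = i \<and> l = j then t else 0)) r c I J' =
      monomer_dimer w r c I J'" for J'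
    by (rule monomer_dimer_cong) (use assms in auto)
  moreover have "(\<Sum>k\<in>J. (w i k + (if k = j then t else 0)) * f k) = (\<Sum>k\<in>J. w i k * f k)"
    for f :: "'b \<Rightarrow> real"
    by (rule sum.cong) (use assms in auto)
  moreover have "insert j J - {j} = J" using assms by simp
  ultimately show ?thesis
    using assms by (simp add: monomer_dimer_insert_row distrib_right[of _ _ "monomer_dimer w r c I J"])
qed

text \<open>Vanishing monomer weights leave only perfect matchings, which are the graphs of
  permutations.\<close>

lemma monomer_dimer_no_monomers:
  fixes w :: "'a::finite \<Rightarrow> 'a \<Rightarrow> real"
  shows "monomer_dimer w (\<lambda>i. 0) (\<lambda>j. 0) UNIV UNIV = (\<Sum>\<sigma> | \<sigma> permutes UNIV. \<Prod>i\<in>UNIV. w i (\<sigma> i))"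
proof -
  define graph where "graph \<sigma> = range (\<lambda>i::'a. (i, \<sigma> i :: 'a))" for \<sigma>
  define t where "t M = (\<Prod>e\<in>M. w (fst e) (snd e)) *
      (\<Prod>i\<in>UNIV - fst ` M. (0::real)) * (\<Prod>j\<in>UNIV - snd ` M. (0::real))" for M
  have fst_graph: "fst ` graph \<sigma> = UNIV" and snd_graph: "snd ` graph \<sigma> = range \<sigma>" for \<sigma>
    by (auto simp: graph_def image_image)
  have inj: "inj_on graph {\<sigma>. \<sigma> permutes UNIV}"
    by (rule inj_onI) (auto simp: graph_def set_eq_iff image_iff fun_eq_iff)
  have graph_M: "graph \<sigma> \<in> matchings UNIV UNIV" if "\<sigma> permutes UNIV" for \<sigma>
    using permutes_inj[OF that] by (auto simp: matchings_def graph_def inj_on_def)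
  \<comment> \<open>Covering all rows suffices: \<open>\<sigma>\<close> is injective because
    \<open>snd\<close> is injective on \<open>M\<close>, hence bijective by finiteness.\<close>
  have perfect: "M \<in> graph ` {\<sigma>. \<sigma> permutes UNIV}"
    if M: "M \<in> matchings UNIV UNIV" and "fst ` M = UNIV" for M :: "('a \<times> 'a) set"
  proof -
    have "\<exists>j. (i, j) \<in> M" for i
      using that(2) by (metis UNIV_I imageE prod.collapse)
    then obtain \<sigma> where \<sigma>: "(i, \<sigma> i) \<in> M" for i by metis
    have "inj_on fst M" "inj_on snd M" using M by (simp_all add: matchings_def)
    have "inj \<sigma>"
    proof (rule injI)
      fix i k assume "\<sigma> i = \<sigma> k"
      then show "i = k"
        using inj_onD[OF \<open>inj_on snd M\<close>, of "(i, \<sigma> i)" "(k, \<sigma> k)"] \<sigma>[of i] \<sigma>[of k] by simp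
    qed
    then have "\<sigma> permutes UNIV"
      by (intro bij_imp_permutes) (auto simp: bij_def finite_UNIV_inj_surj)
    moreover have "M = graph \<sigma>"
    proof
      show "graph \<sigma> \<subseteq> M" using \<sigma> by (auto simp: graph_def)
      show "M \<subseteq> graph \<sigma>"
      proof
        fix e assume "e \<in> M"
        then have "e = (fst e, \<sigma> (fst e))"
          using inj_onD[OF \<open>inj_on fst M\<close>, of e "(fst e, \<sigma> (fst e))"] \<sigma> by simp
        then show "e \<in> graph \<sigma>" by (auto simp: graph_def)
      qed
    qed
    ultimately show ?thesis by blast
  qed
  have "monomer_dimer w (\<lambda>i. 0) (\<lambda>j. 0) UNIV UNIV = sum t (matchings UNIV UNIV)"
    unfolding monomer_dimer_def t_def ..
  also have "\<dots> = sum t (graph ` {\<sigma>. \<sigma> permutes UNIV})"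
  proof (rule sum.mono_neutral_right)
    show "\<forall>M\<in>matchings UNIV UNIV - graph ` {\<sigma>. \<sigma> permutes UNIV}. t M = 0"
    proof
      fix M :: "('a \<times> 'a) set"
      assume "M \<in> matchings UNIV UNIV - graph ` {\<sigma>. \<sigma> permutes UNIV}"
      then have "UNIV - fst ` M \<noteq> {}" using perfect by blast
      then have "(\<Prod>i\<in>UNIV - fst ` M. (0::real)) = 0"
        by (intro prod_zero) (blast intro: finite)+
      then show "t M = 0" by (simp add: t_def)
    qed
  qed (use graph_M in \<open>auto simp: finite_matchings\<close>)
  also have "\<dots> = (\<Sum>\<sigma> | \<sigma> permutes UNIV. t (graph \<sigma>))"
    using sum.reindex[OF inj, of t] by simp
  also have "\<dots> = (\<Sum>\<sigma> | \<sigma> permutes UNIV. \<Prod>i\<in>UNIV. w i (\<sigma> i))"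
  proof (rule sum.cong)
    fix \<sigma> :: "'a \<Rightarrow> 'a" assume "\<sigma> \<in> {\<sigma>. \<sigma> permutes UNIV}"
    then have "range \<sigma> = UNIV" by (auto dest: permutes_surj)
    moreover have "(\<Prod>e\<in>graph \<sigma>. w (fst e) (snd e)) = (\<Prod>i\<in>UNIV. w i (\<sigma> i))"
      unfolding graph_def by (subst prod.reindex) (auto simp: inj_on_def)
    ultimately show "t (graph \<sigma>) = (\<Prod>i\<in>UNIV. w i (\<sigma> i))"
      by (simp add: t_def fst_graph snd_graph)
  qed simp
  finally show ?thesis .
qed

section \<open>Eliminating the edges one at a time\<close>

text \<open>Weighted AM-GM for the numbers \<open>x j / b j\<close> with weights \<open>b j\<close>,
  from Jensen's inequality for \<open>exp\<close>.\<close>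

lemma exp_sum_ln_le_sum:
  fixes x b :: "'a \<Rightarrow> real"
  assumes "finite S" and b: "sum b S = 1" "\<And>j. j \<in> S \<Longrightarrow> b j \<ge> 0"
    and x: "\<And>j. j \<in> S \<Longrightarrow> x j \<ge> 0" "\<And>j. j \<in> S \<Longrightarrow> b j > 0 \<Longrightarrow> x j > 0"
  shows "exp (\<Sum>j\<in>S. b j * ln (x j / b j)) \<le> sum x S"
proof -
  have "S \<noteq> {}" using b(1) by auto
  have "exp (\<Sum>j\<in>S. b j * ln (x j / b j)) \<le> (\<Sum>j\<in>S. b j * exp (ln (x j / b j)))"
    using convex_on_sum[OF \<open>finite S\<close> \<open>S \<noteq> {}\<close> exp_convex b, of "\<lambda>j. ln (x j / b j)"] by simp
  also have "\<dots> \<le> sum x S"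
  proof (rule sum_mono)
    fix j assume j: "j \<in> S"
    \<comment> \<open>Equality holds where \<open>b j > 0\<close>; where \<open>b j = 0\<close> the
      left side is 0 although the logarithm is a default value.\<close>
    show "b j * exp (ln (x j / b j)) \<le> x j"
      by (cases "b j = 0") (use x[of j] b(2)[of j] j in auto)
  qed
  finally show ?thesis .
qed

text \<open>Fixing \<open>y * z = t\<close> and minimising bounds \<open>C * t powr b\<close> by
  \<open>(p + q) * (1 + t)\<close>. The claim follows because the supremum of
  \<open>t powr b / (1 + t)\<close> over \<open>t > 0\<close> is
  \<open>b powr b * (1 - b) powr (1 - b)\<close>, with \<open>0 powr 0\<close> read as 1.\<close>

lemma bilinear_capacity_le:
  fixes p q u v b C :: real
  assumes nonneg: "p \<ge> 0" "q \<ge> 0" "u \<ge> 0" "v \<ge> 0" and uv: "u * v \<le> p * q" and b: "0 \<le> b" "b \<le> 1"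
    and cap: "\<And>y z. y > 0 \<Longrightarrow> z > 0 \<Longrightarrow> C * exp (b * ln (y * z)) \<le> p + u * y + v * z + q * (y * z)"
  shows "C * exp (b * ln b + (1 - b) * ln (1 - b)) \<le> p + q"
proof -
  \<comment> \<open>Choose \<open>y * z = t\<close> to minimise \<open>u * y + v * z\<close>; since \<open>u\<close> or \<open>v\<close> may vanish, the minimum
    \<open>2 * sqrt (t * u * v)\<close> is only reached in the limit \<open>\<epsilon> \<rightarrow> 0\<close>.\<close>
  have *: "C * exp (b * ln t) \<le> (p + q) * (1 + t)" if t: "t > 0" for t
  proof -
    have "C * exp (b * ln t) \<le> p + q * t + 2 * sqrt (t * ((u + \<epsilon>) * (v + \<epsilon>)))" if \<epsilon>: "\<epsilon> > 0" for \<epsilon>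
    proof -
      define y where "y = sqrt (t * ((v + \<epsilon>) / (u + \<epsilon>)))"
      define z where "z = sqrt (t * ((u + \<epsilon>) / (v + \<epsilon>)))"
      have pos: "u + \<epsilon> > 0" "v + \<epsilon> > 0" using \<epsilon> nonneg by auto
      have yz: "y > 0" "z > 0" using pos t by (auto simp: y_def z_def)
      have "t * ((v + \<epsilon>) / (u + \<epsilon>)) * (t * ((u + \<epsilon>) / (v + \<epsilon>))) = t * t"
        using pos by simp
      then have "y * z = sqrt (t * t)"
        unfolding y_def z_def real_sqrt_mult[symmetric] by simp
      then have t_eq: "y * z = t" using t by simp
      have "(u + \<epsilon>) * y = sqrt ((u + \<epsilon>)\<^sup>2 * (t * ((v + \<epsilon>) / (u + \<epsilon>))))"
        using pos unfolding y_def real_sqrt_mult by simp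
      also have "(u + \<epsilon>)\<^sup>2 * (t * ((v + \<epsilon>) / (u + \<epsilon>))) = t * ((u + \<epsilon>) * (v + \<epsilon>))"
        using pos by (simp add: field_simps power2_eq_square)
      finally have uy: "(u + \<epsilon>) * y = sqrt (t * ((u + \<epsilon>) * (v + \<epsilon>)))" .
      have "(v + \<epsilon>) * z = sqrt ((v + \<epsilon>)\<^sup>2 * (t * ((u + \<epsilon>) / (v + \<epsilon>))))"
        using pos unfolding z_def real_sqrt_mult by simp
      also have "(v + \<epsilon>)\<^sup>2 * (t * ((u + \<epsilon>) / (v + \<epsilon>))) = t * ((u + \<epsilon>) * (v + \<epsilon>))"
        using pos by (simp add: field_simps power2_eq_square)
      finally have vz: "(v + \<epsilon>) * z = sqrt (t * ((u + \<epsilon>) * (v + \<epsilon>)))" .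
      have "u * y \<le> (u + \<epsilon>) * y" "v * z \<le> (v + \<epsilon>) * z"
        using yz \<epsilon> by (auto intro: mult_right_mono)
      then show ?thesis using cap[OF yz] unfolding t_eq uy vz by linarith
    qed
    moreover have "((\<lambda>\<epsilon>. p + q * t + 2 * sqrt (t * ((u + \<epsilon>) * (v + \<epsilon>)))) \<longlongrightarrow>
        p + q * t + 2 * sqrt (t * ((u + 0) * (v + 0)))) (at_right 0)"
      by (intro tendsto_intros)
    ultimately have "C * exp (b * ln t) \<le> p + q * t + 2 * sqrt (t * ((u + 0) * (v + 0)))"
      by (intro tendsto_lowerbound[where F = "at_right (0::real)"])
         (auto simp: eventually_at_right_field intro: exI[of _ 1])
    \<comment> \<open>The grouping \<open>(t * p) * q\<close> makes AM-GM yield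
      \<open>t * p + q\<close>, which completes \<open>p + q * t\<close> to
      \<open>(p + q) * (1 + t)\<close>.\<close>
    also have "sqrt (t * ((u + 0) * (v + 0))) \<le> sqrt ((t * p) * q)"
      using uv t by (simp add: mult.assoc)
    also have "\<dots> \<le> (t * p + q) / 2"
      by (rule arith_geo_mean_sqrt) (use nonneg t in auto)
    finally show ?thesis by (simp add: field_simps)
  qed
  \<comment> \<open>At the end points the supremum is only a limit: \<open>t\<close> tends to 0 for
    \<open>b = 0\<close> and to infinity for \<open>b = 1\<close>, where
    \<open>t = 1 / s\<close>.\<close>
  consider "b = 0" | "b = 1" | "0 < b" "b < 1" using b by linarith
  then show ?thesis
  proof cases
    case 1
    have "((\<lambda>t. (p + q) * (1 + t)) \<longlongrightarrow> (p + q) * (1 + 0)) (at_right 0)"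
      by (intro tendsto_intros)
    then have "C \<le> (p + q) * (1 + 0)"
      by (rule tendsto_lowerbound)
         (use * 1 in \<open>auto simp: eventually_at_right_field intro: exI[of _ 1]\<close>)
    then show ?thesis using 1 by simp
  next
    case 2
    have "C \<le> (p + q) * (1 + s)" if s: "s > 0" for s
    proof -
      have "C * (1 / s) \<le> (p + q) * (1 + 1 / s)" using *[of "1 / s"] s 2 by simp
      then show ?thesis using s by (simp add: field_simps)
    qed
    moreover have "((\<lambda>t. (p + q) * (1 + t)) \<longlongrightarrow> (p + q) * (1 + 0)) (at_right 0)"
      by (intro tendsto_intros)
    ultimately have "C \<le> (p + q) * (1 + 0)"
      by (intro tendsto_lowerbound[where F = "at_right (0::real)"])
         (auto simp: eventually_at_right_field intro: exI[of _ 1])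
    then show ?thesis using 2 by simp
  next
    case 3
    \<comment> \<open>\<open>t = b / (1 - b)\<close> maximises \<open>t powr b / (1 + t)\<close>.\<close>
    then have ln: "ln (b / (1 - b)) = ln b - ln (1 - b)" by (simp add: ln_div)
    have "C * exp (b * ln (b / (1 - b))) * (1 - b) \<le> (p + q) * (1 + b / (1 - b)) * (1 - b)"
      using *[of "b / (1 - b)"] 3 by (intro mult_right_mono) auto
    also have "\<dots> = p + q" using 3 by (simp add: field_simps)
    also have "C * exp (b * ln (b / (1 - b))) * (1 - b) =
        C * (exp (b * ln (b / (1 - b))) * exp (ln (1 - b)))"
      using 3 by simp
    also have "\<dots> = C * exp (b * ln b + (1 - b) * ln (1 - b))"
      unfolding exp_add[symmetric] ln by (simp add: algebra_simps)
    finally show ?thesis .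
  qed
qed

section \<open>Elimination of edges\<close>

text \<open>The polynomial left after eliminating the edges in \<open>S\<close>. The coefficient
  \<open>a\<close> accompanies \<open>y\<close> only, so that an eliminated edge gets dimer weight
  \<open>a e\<close> rather than its square.\<close>

definition partial_elim ::
  "('a::finite \<times> 'b::finite) set \<Rightarrow> ('a \<times> 'b \<Rightarrow> real) \<Rightarrow> ('a \<times> 'b \<Rightarrow> real) \<Rightarrow> ('a \<times> 'b \<Rightarrow> real) \<Rightarrow> real" where
  "partial_elim S a y z =
     monomer_dimer (\<lambda>i j. if (i, j) \<in> S then a (i, j) else 0)
       (\<lambda>i. \<Sum>j | (i, j) \<notin> S. a (i, j) * y (i, j)) (\<lambda>j. \<Sum>i | (i, j) \<notin> S. z (i, j)) UNIV UNIV"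

text \<open>With the other variables fixed, the polynomial is bilinear in the two variables at
  \<open>e\<close>. The correlation inequality supplies the condition on its coefficients, and
  \<open>bilinear_capacity_le\<close> bounds the result.\<close>

lemma partial_elim_step:
  fixes S :: "('a::finite \<times> 'b::finite) set"
  assumes a: "\<And>e. a e \<ge> 0" and yz: "\<And>e. y e > 0" "\<And>e. z e > 0" and e: "e \<notin> S"
    and b: "0 \<le> b" "b \<le> 1"
    and cap: "\<And>s t. s > 0 \<Longrightarrow> t > 0 \<Longrightarrow>
      C * exp (b * ln (s * t)) \<le> partial_elim S a (y(e := s)) (z(e := t))"
  shows "C * exp (b * ln b + (1 - b) * ln (1 - b)) \<le> partial_elim (insert e S) a y z"
proof -
  obtain i j where ij: "e = (i, j)" by (cases e)
  let ?S = "insert e S"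
  \<comment> \<open>In these weights \<open>e\<close> is neither a dimer nor part of a monomer form;
    adding it back in either role gives the polynomial before or after the elimination.\<close>
  define w where "w k l = (if (k, l) \<in> S then a (k, l) else 0)" for k l
  define r where "r k = (\<Sum>l | (k, l) \<notin> ?S. a (k, l) * y (k, l))" for k
  define c where "c l = (\<Sum>k | (k, l) \<notin> ?S. z (k, l))" for l
  let ?Z = "monomer_dimer w r c"
  define I where "I = UNIV - {i}"
  define J where "J = UNIV - {j}"
  have I: "UNIV = insert i I" "i \<notin> I" and J: "UNIV = insert j J" "j \<notin> J"
    by (auto simp: I_def J_def)
  have nonneg: "w k l \<ge> 0" "r k \<ge> 0" "c l \<ge> 0" for k l
    using a yz[THEN less_imp_le] by (auto simp: w_def r_def c_def intro!: sum_nonneg)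
  have row: "(\<Sum>l | (k, l) \<notin> S. a (k, l) * (y(e := s)) (k, l)) = r k + (if k = i then a e * s else 0)"
    for k s
  proof -
    have "(\<Sum>l | (k, l) \<notin> S. a (k, l) * (y(e := s)) (k, l)) =
        (\<Sum>l | (k, l) \<notin> ?S. a (k, l) * (y(e := s)) (k, l)) +
        (\<Sum>l | (k, l) = e. a (k, l) * (y(e := s)) (k, l))"
      by (subst sum.union_disjoint[symmetric]) (use e in \<open>auto intro!: sum.cong\<close>)
    also have "(\<Sum>l | (k, l) \<notin> ?S. a (k, l) * (y(e := s)) (k, l)) = r k"
      unfolding r_def by (rule sum.cong) auto
    also have "(\<Sum>l | (k, l) = e. a (k, l) * (y(e := s)) (k, l)) = (if k = i then a e * s else 0)"
      by (auto simp: ij)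
    finally show ?thesis .
  qed
  have col: "(\<Sum>k | (k, l) \<notin> S. (z(e := t)) (k, l)) = c l + (if l = j then t else 0)" for l t
  proof -
    have "(\<Sum>k | (k, l) \<notin> S. (z(e := t)) (k, l)) =
        (\<Sum>k | (k, l) \<notin> ?S. (z(e := t)) (k, l)) + (\<Sum>k | (k, l) = e. (z(e := t)) (k, l))"
      by (subst sum.union_disjoint[symmetric]) (use e in \<open>auto intro!: sum.cong\<close>)
    also have "(\<Sum>k | (k, l) \<notin> ?S. (z(e := t)) (k, l)) = c l"
      unfolding c_def by (rule sum.cong) auto
    also have "(\<Sum>k | (k, l) = e. (z(e := t)) (k, l)) = (if l = j then t else 0)"
      by (auto simp: ij)
    finally show ?thesis .
  qed
  have expand: "partial_elim S a (y(e := s)) (z(e := t)) =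
      ?Z UNIV UNIV + a e * ?Z I UNIV * s + ?Z UNIV J * t + a e * ?Z I J * (s * t)" for s t
  proof -
    have "partial_elim S a (y(e := s)) (z(e := t)) =
        monomer_dimer w (\<lambda>k. r k + (if k = i then a e * s else 0))
          (\<lambda>l. c l + (if l = j then t else 0)) (insert i I) (insert j J)"
      unfolding partial_elim_def row col w_def[symmetric] I(1)[symmetric] J(1)[symmetric] ..
    also have "\<dots> = ?Z (insert i I) (insert j J) + a e * ?Z I (insert j J) * s +
        ?Z (insert i I) J * t + a e * ?Z I J * (s * t)"
      using I(2) J(2) by (simp add: monomer_dimer_add_row monomer_dimer_add_col algebra_simps)
    finally show ?thesis unfolding I(1)[symmetric] J(1)[symmetric] .
  qed
  have "C * exp (b * ln b + (1 - b) * ln (1 - b)) \<le> ?Z UNIV UNIV + a e * ?Z I J"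
  proof (rule bilinear_capacity_le[where u = "a e * ?Z I UNIV" and v = "?Z UNIV J"])
    have "?Z I UNIV * ?Z UNIV J \<le> ?Z UNIV UNIV * ?Z I J"
      using monomer_dimer_rayleigh(1)[of w r c I J i j] nonneg I J by simp
    then show "a e * ?Z I UNIV * ?Z UNIV J \<le> ?Z UNIV UNIV * (a e * ?Z I J)"
      using mult_left_mono[OF _ a[of e]] by (fastforce simp: mult_ac)
    show "C * exp (b * ln (s * t)) \<le> ?Z UNIV UNIV + a e * ?Z I UNIV * s + ?Z UNIV J * t +
        a e * ?Z I J * (s * t)" if "s > 0" "t > 0" for s t
      using cap[OF that] unfolding expand .
  qed (use a[of e] b nonneg in \<open>auto intro!: mult_nonneg_nonneg monomer_dimer_nonneg\<close>)
  also have "\<dots> = monomer_dimer (\<lambda>k l. w k l + (if k = i \<and> l = j then a e else 0)) r c UNIV UNIV"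
    using monomer_dimer_add_edge[OF _ _ I(2) J(2), of w "a e" r c] I J by simp
  also have "(\<lambda>k l. w k l + (if k = i \<and> l = j then a e else 0)) =
      (\<lambda>k l. if (k, l) \<in> ?S then a (k, l) else 0)"
    using e by (auto simp: fun_eq_iff w_def ij)
  finally show ?thesis unfolding partial_elim_def r_def c_def .
qed

text \<open>Entropy terms are written with \<open>ln\<close> throughout: Isabelle's \<open>ln 0 = 0\<close> and \<open>x / 0 = 0\<close> make
  those with \<open>b e = 0\<close> or \<open>b e = 1\<close> vanish, in accordance with \<open>0 powr 0 = 1\<close> on paper.\<close>

lemma partial_elim_ge:
  fixes S :: "('a::finite \<times> 'b::finite) set" and a b y z :: "'a \<times> 'b \<Rightarrow> real"
  assumes a: "\<And>e. a e \<ge> 0" and b: "\<And>e. 0 \<le> b e" "\<And>e. b e \<le> 1"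
    and rows: "\<And>i. (\<Sum>j\<in>UNIV. b (i, j)) = 1" and cols: "\<And>j. (\<Sum>i\<in>UNIV. b (i, j)) = 1"
    and supp: "\<And>e. b e > 0 \<Longrightarrow> a e > 0"
    and "\<And>e. y e > 0" "\<And>e. z e > 0"
  shows "exp (\<Sum>e\<in>UNIV. b e * ln (a e / b e) - b e * ln (b e)) *
      exp (\<Sum>e\<in>S. b e * ln (b e) + (1 - b e) * ln (1 - b e)) *
      exp (\<Sum>e\<in>-S. b e * ln (y e * z e)) \<le> partial_elim S a y z"
  using finite[of S] assms(7,8)
proof (induction S arbitrary: y z rule: finite_induct)
  case empty
  \<comment> \<open>One divisor \<open>b e\<close> goes to the row variable and one to the column
    variable, so that AM-GM applies to every row sum and every column sum.\<close>
  have "exp (\<Sum>e\<in>UNIV. b e * ln (a e / b e) - b e * ln (b e)) * exp (\<Sum>e\<in>UNIV. b e * ln (y e * z e)) =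
      exp (\<Sum>e\<in>UNIV. b e * ln (a e * y e / b e) + b e * ln (z e / b e))"
    unfolding exp_add[symmetric] sum.distrib[symmetric]
  proof (intro arg_cong[where f = exp] sum.cong refl)
    fix e
    show "b e * ln (a e / b e) - b e * ln (b e) + b e * ln (y e * z e) =
        b e * ln (a e * y e / b e) + b e * ln (z e / b e)"
    proof (cases "b e = 0")
      case False
      then have "b e > 0" using b(1)[of e] by linarith
      then show ?thesis
        using supp[of e] empty.prems(1)[of e] empty.prems(2)[of e]
        by (simp add: ln_mult ln_div algebra_simps)
    qed simp
  qed
  also have "(\<Sum>e\<in>UNIV. b e * ln (a e * y e / b e) + b e * ln (z e / b e)) =
      (\<Sum>i\<in>UNIV. \<Sum>j\<in>UNIV. b (i, j) * ln (a (i, j) * y (i, j) / b (i, j))) +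
      (\<Sum>j\<in>UNIV. \<Sum>i\<in>UNIV. b (i, j) * ln (z (i, j) / b (i, j)))"
    unfolding sum.distrib sum.swap[of _ "UNIV :: 'a set" "UNIV :: 'b set"]
    by (simp add: sum.cartesian_product split_def flip: UNIV_Times_UNIV)
  also have "exp \<dots> = (\<Prod>i\<in>UNIV. exp (\<Sum>j\<in>UNIV. b (i, j) * ln (a (i, j) * y (i, j) / b (i, j)))) *
      (\<Prod>j\<in>UNIV. exp (\<Sum>i\<in>UNIV. b (i, j) * ln (z (i, j) / b (i, j))))"
    by (simp add: exp_add exp_sum)
  also have "\<dots> \<le> (\<Prod>i\<in>UNIV. \<Sum>j\<in>UNIV. a (i, j) * y (i, j)) * (\<Prod>j\<in>UNIV. \<Sum>i\<in>UNIV. z (i, j))"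
    by (intro mult_mono prod_mono conjI exp_sum_ln_le_sum prod_nonneg sum_nonneg)
      (use a b rows cols supp empty.prems empty.prems[THEN less_imp_le] in auto)
  also have "\<dots> = partial_elim {} a y z"
    by (simp add: partial_elim_def monomer_dimer_no_dimers)
  finally show ?case by simp
next
  case (insert e S)
  let ?K = "exp (\<Sum>e\<in>UNIV. b e * ln (a e / b e) - b e * ln (b e))"
  let ?h = "\<lambda>e. b e * ln (b e) + (1 - b e) * ln (1 - b e)"
  \<comment> \<open>Here \<open>C\<close> collects all factors free of the variables at
    \<open>e\<close>; the induction hypothesis, with those variables updated, is the required
    capacity bound.\<close>
  have "?K * exp (sum ?h S) * exp (\<Sum>f\<in>-insert e S. b f * ln (y f * z f)) * exp (?h e)
      \<le> partial_elim (insert e S) a y z"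
  proof (rule partial_elim_step)
    fix s t :: real assume st: "s > 0" "t > 0"
    let ?y = "y(e := s)" and ?z = "z(e := t)"
    have "-S = insert e (-insert e S)" using insert.hyps by auto
    then have "(\<Sum>f\<in>-S. b f * ln (?y f * ?z f)) =
        b e * ln (s * t) + (\<Sum>f\<in>-insert e S. b f * ln (?y f * ?z f))"
      by (metis (no_types, lifting) ComplD finite fun_upd_same insertI1 sum.insert)
    also have "(\<Sum>f\<in>-insert e S. b f * ln (?y f * ?z f)) = (\<Sum>f\<in>-insert e S. b f * ln (y f * z f))"
      by (rule sum.cong) auto
    finally have "exp (\<Sum>f\<in>-S. b f * ln (?y f * ?z f)) =
        exp (\<Sum>f\<in>-insert e S. b f * ln (y f * z f)) * exp (b e * ln (s * t))"
      by (simp add: exp_add)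
    moreover have "?K * exp (sum ?h S) * exp (\<Sum>f\<in>-S. b f * ln (?y f * ?z f)) \<le> partial_elim S a ?y ?z"
      by (rule insert.IH) (use insert.prems st in auto)
    ultimately show "?K * exp (sum ?h S) * exp (\<Sum>f\<in>-insert e S. b f * ln (y f * z f)) * exp (b e * ln (s * t))
        \<le> partial_elim S a ?y ?z"
      by (simp only: mult.assoc)
  qed (use a b insert in auto)
  then show ?case using insert.hyps by (simp add: exp_add mult_ac)
qed

section \<open>The lower bound for the permanent\<close>

lemma pow0_self: "x \<ge> 0 \<Longrightarrow> pow0 x x = exp (x * ln x)"
  by (auto simp: pow0_def powr_def)

lemma doubly_stochastic_le_1:
  assumes "doubly_stochastic B"
  shows "B $ i $ j \<le> 1"
proof -
  have "B $ i $ j \<le> (\<Sum>j\<in>UNIV. B $ i $ j)"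
    by (rule member_le_sum) (use assms in \<open>auto simp: doubly_stochastic_def nonneg_mat_def\<close>)
  then show ?thesis using assms by (simp add: doubly_stochastic_def)
qed

lemma per_ge_per_lower_bound:
  fixes A B :: "real^'n^'n"
  assumes A: "nonneg_mat A" and B: "doubly_stochastic B"
  shows "per_lower_bound A B \<le> per A"
proof (cases "\<exists>i j. B $ i $ j > 0 \<and> A $ i $ j = 0")
  case True
  then show ?thesis
    using A by (auto simp: per_lower_bound_def per_def nonneg_mat_def intro!: sum_nonneg prod_nonneg)
next
  case False
  define a b where "a e = A $ fst e $ snd e" and "b e = B $ fst e $ snd e" for e
  let ?D = "\<lambda>e. b e * ln (a e / b e)" and ?H = "\<lambda>e. (1 - b e) * ln (1 - b e)"
  have A0: "A $ i $ j \<ge> 0" for i j using A by (simp add: nonneg_mat_def)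
  have B0: "B $ i $ j \<ge> 0" for i j using B by (simp add: doubly_stochastic_def nonneg_mat_def)
  have pos: "A $ i $ j > 0" if "B $ i $ j > 0" for i j
    using False that A0[of i j] by (metis order_le_less)
  have kl: "kl_term (B $ i $ j) (A $ i $ j) = - ?D (i, j)" for i j
    using pos[of i j] B0[of i j] by (auto simp: kl_term_def a_def b_def ln_div algebra_simps)
  have "per_lower_bound A B = (\<Prod>i\<in>UNIV. \<Prod>j\<in>UNIV. exp (?H (i, j))) * exp (\<Sum>i\<in>UNIV. \<Sum>j\<in>UNIV. ?D (i, j))"
    using False doubly_stochastic_le_1[OF B]
    by (simp add: per_lower_bound_def pow0_self kl sum_negf b_def)
  also have "\<dots> = exp ((\<Sum>e\<in>UNIV. ?D e) + (\<Sum>e\<in>UNIV. ?H e))"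
    by (simp add: exp_add exp_sum prod.cartesian_product flip: UNIV_Times_UNIV)
  \<comment> \<open>The terms \<open>b e * ln (b e)\<close> from AM-GM and from the eliminations
    cancel. The last exponent is an empty sum, written to match \<open>partial_elim_ge\<close> with
    all variables equal to 1.\<close>
  also have "\<dots> = exp (\<Sum>e\<in>UNIV. ?D e - b e * ln (b e)) *
      exp (\<Sum>e\<in>UNIV. b e * ln (b e) + (1 - b e) * ln (1 - b e)) * exp (\<Sum>e\<in>-UNIV. b e * ln (1 * 1))"
    by (simp add: sum_subtractf sum.distrib flip: exp_add)
  also have "\<dots> \<le> partial_elim UNIV a (\<lambda>_. 1) (\<lambda>_. 1)"
    by (rule partial_elim_ge)
      (use A0 B0 pos B doubly_stochastic_le_1[OF B] in \<open>auto simp: a_def b_def doubly_stochastic_def\<close>)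
  also have "\<dots> = per A"
    by (simp add: partial_elim_def monomer_dimer_no_monomers per_def a_def)
  finally show ?thesis .
qed

theorem theorem1p2:
  fixes A B :: "real^'n^'n"
  shows "(nonneg_mat A \<and> doubly_stochastic B \<longrightarrow> per A \<ge> per_lower_bound A B) \<and>
         (doubly_stochastic A \<longrightarrow>
            per A \<ge> (\<Prod>i\<in>UNIV. \<Prod>j\<in>UNIV. pow0 (1 - A $ i $ j) (1 - A $ i $ j)))"
proof (intro conjI impI)
  show "per A \<ge> per_lower_bound A B" if "nonneg_mat A \<and> doubly_stochastic B"
    using that per_ge_per_lower_bound by blast
  assume A: "doubly_stochastic A"
  \<comment> \<open>For \<open>B = A\<close> the divergence is finite and vanishes term by
    term.\<close>
  have "\<not> (\<exists>i j. A $ i $ j > 0 \<and> A $ i $ j = 0)" by auto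
  moreover have "kl_term x x = 0" for x by (simp add: kl_term_def)
  ultimately have "per_lower_bound A A = (\<Prod>i\<in>UNIV. \<Prod>j\<in>UNIV. pow0 (1 - A $ i $ j) (1 - A $ i $ j))"
    unfolding per_lower_bound_def by (simp only: if_False sum.neutral_const) simp
  then show "per A \<ge> (\<Prod>i\<in>UNIV. \<Prod>j\<in>UNIV. pow0 (1 - A $ i $ j) (1 - A $ i $ j))"
    using per_ge_per_lower_bound[of A A] A by (simp add: doubly_stochastic_def)
qed

end
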